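(* Let $r\leqslant 1$ be an odd integer coprime with $5$. Let $p$ be a prime such that $p\equiv -\frac{r}{2}\pmod{5}$ (i.e. $2p\equiv -r \pmod 5$) and $p\geqslant \frac{5-r}{2}$. Then $$\sum_{k=0}^{p-1}(10k+r)\frac{\left(\frac{r}{5}\right)_k^5}{k!^5}\equiv 0 \pmod{p^4}.$$
   Context: For a complex (here rational) number $a$ and a non-negative integer $k$, $(a)_k=a(a+1)\cdots(a+k-1)$ denotes the Pochhammer symbol, with $(a)_0=1$. The sum is a rational number whose denominator is not divisible by $p$; a congruence modulo $p^m$ between such rational numbers means their difference is $p^m$ times a rational number with denominator coprime to $p$ (equivalently, congruence in $\mathbb{Z}_p$). *)

theory Defs
  imports Complex_Main "HOL-Computational_Algebra.Primes" "HOL-Number_Theory.Cong"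
begin

definition rat_cong_pow :: "rat \<Rightarrow> rat \<Rightarrow> nat \<Rightarrow> nat \<Rightarrow> bool" where
  "rat_cong_pow x y p m \<longleftrightarrow>
     (\<exists>a b :: int. b \<noteq> 0 \<and> \<not> (int p dvd b) \<and>
        x - y = of_nat (p ^ m) * (of_int a / of_int b))"

end

(* Put a = r/5, x = 3p/5, y = p/5 and n = (3p - r)/5, so that a = x - n.  Deform the sum to
     S(X, t) = sum_{k<p} (a + 2k) (a)_k / k! * prod_{l<k} ((a+l)^2 - X) ((a+l)^2 - t) / (((l+1)^2 - X) ((l+1)^2 - t)),
   so that the sum in question is 5 S(0, 0).  The factors (z^2 - x^2)(z^2 + x^2) = z^4 - x^4 show that
   S(0, 0) = S(x^2, -x^2) modulo p^4.  For X = x^2 the sum terminates at k = n, and Whipple's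
   transformation writes it as a sum in which t occurs only in p-integral factors with coefficients
   divisible by p^2; hence S(x^2, t) modulo p^4 does not depend on t in p^2 Z_p.  Finally
   S(x^2, y^2) = 0: applying Whipple's transformation with the four parameters a +- x, a +- y paired
   differently, every summand on the other side vanishes. *)
theory Submission
  imports Defs
begin

text \<open>The numbers 3/5 and 1/5 solve a linear system. Once \<open>a - x = -n\<close> and the
  auxiliary parameter \<open>(1 + a)/2\<close> are placed, Whipple's transformation has three slots
  left: \<open>c\<close> and the symmetric pair \<open>d, e\<close>. With \<open>c = a + y\<close>
  and \<open>{d, e} = {a + x, a - y}\<close> the j-th summand carries the symbols
  \<open>((1 + n - x - 2y)/2)_j\<close> and \<open>(1 + n - 2x + y)_(n-j)\<close>. Their arguments
  become the integers \<open>(1 + n - p)/2\<close> and \<open>1 + n - p\<close> when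
  \<open>x + 2y = p\<close> and \<open>2x - y = p\<close>, that is, \<open>x = 3p/5\<close> and
  \<open>y = p/5\<close>. The hypothesis on p modulo 5 says that \<open>n = (3p - r)/5\<close> is an
  integer. With \<open>c = a + x\<close> and \<open>d, e\<close> the two roots
  \<open>a +- sqrt t\<close>, the same symbols miss zero only by a multiple of \<open>y\<close>:
  they contribute one factor p, and \<open>(a)_(n+j+1)\<close>, which contains
  \<open>a + n = x\<close>, contributes the other. Replacing only \<open>X = 0\<close> by
  \<open>x^2\<close> would cost an error of order \<open>p^2\<close>; the simultaneous choice
  \<open>t = -x^2\<close> cancels the quadratic term.\<close>

section \<open>Whipple's transformation\<close>

text \<open>The right-hand side is the certificate of creative telescoping in \<open>k\<close>, multiplied out so that
  the factor \<open>k + 1 - j\<close>, which vanishes at the end of the summation range, is not a denominator.\<close>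

lemma saalschuetz_partial:
  fixes a b c :: "'a::field_char_0" and k m :: nat
  assumes b: "\<And>l. 1 + a - b + of_nat l \<noteq> 0" and c: "\<And>l. 1 + a - c + of_nat l \<noteq> 0"
  defines "f \<equiv> \<lambda>k j. pochhammer (- of_nat k) j * pochhammer (a + of_nat k) j *
      pochhammer (1 + a - b - c) j /
      (fact j * pochhammer (1 + a - b) j * pochhammer (1 + a - c) j)"
  shows "(\<Sum>j\<le>m. (1 + a - b + of_nat k) * (1 + a - c + of_nat k) * f (Suc k) j -
            (b + of_nat k) * (c + of_nat k) * f k j) =
     (2 * of_nat k + 1 + a) * pochhammer (- of_nat k) m * pochhammer (a + of_nat k + 1) m *
       pochhammer (1 + a - b - c) (Suc m) /
       (fact m * pochhammer (1 + a - b) m * pochhammer (1 + a - c) m)"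
proof (induction m)
  case 0
  show ?case by (simp add: f_def algebra_simps)
next
  case (Suc m)
  define K :: 'a where "K = of_nat k"
  define M :: 'a where "M = of_nat m"
  define P where "P = pochhammer (- K) m"
  define Q where "Q = pochhammer (a + K + 1) m"
  define R where "R = pochhammer (1 + a - b - c) m"
  define B where "B = pochhammer (1 + a - b) m"
  define C where "C = pochhammer (1 + a - c) m"
  define F :: 'a where "F = fact m"
  have nz: "B \<noteq> 0" "C \<noteq> 0" "F \<noteq> 0" "1 + a - b + M \<noteq> 0" "1 + a - c + M \<noteq> 0" "1 + M \<noteq> 0"
    using b c by (auto simp: B_def C_def F_def M_def pochhammer_eq_0_iff eq_neg_iff_add_eq_0)
      (metis of_nat_Suc of_nat_eq_0_iff nat.distinct(1))
  have 1: "pochhammer (- of_nat (Suc k)) (Suc m) = - (K + 1) * P"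
    by (simp add: pochhammer_rec K_def P_def algebra_simps)
  have 2: "pochhammer (a + of_nat (Suc k)) (Suc m) = Q * (a + K + 1 + M)"
    by (simp add: pochhammer_Suc K_def Q_def M_def algebra_simps)
  have 3: "pochhammer (a + of_nat k) (Suc m) = (a + K) * Q"
    by (simp add: pochhammer_rec K_def Q_def algebra_simps)
  have 4: "pochhammer (- of_nat k) (Suc m) = P * (M - K)"
    by (simp add: pochhammer_Suc K_def P_def M_def algebra_simps)
  have 5: "pochhammer (a + of_nat k + 1) (Suc m) = Q * (a + K + 1 + M)"
    by (simp add: pochhammer_Suc K_def Q_def M_def algebra_simps)
  have 6: "fact (Suc m) = (1 + M) * F"
    by (simp add: F_def M_def)
  have eq: "(1 + a - b + K) * (1 + a - c + K) *
        ((- (K + 1) * P) * (Q * (a + K + 1 + M)) * (R * (1 + a - b - c + M)) /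
        ((1 + M) * F * (B * (1 + a - b + M)) * (C * (1 + a - c + M)))) -
      (b + K) * (c + K) *
        (P * (M - K) * ((a + K) * Q) * (R * (1 + a - b - c + M)) /
        ((1 + M) * F * (B * (1 + a - b + M)) * (C * (1 + a - c + M)))) +
      (2 * K + 1 + a) * P * Q * (R * (1 + a - b - c + M)) / (F * B * C) =
      (2 * K + 1 + a) * (P * (M - K)) * (Q * (a + K + 1 + M)) *
       (R * (1 + a - b - c + M) * (1 + a - b - c + (M + 1))) /
       ((1 + M) * F * (B * (1 + a - b + M)) * (C * (1 + a - c + M)))"
  proof -
    \<comment> \<open>\<open>X\<close> is the common factor of all four terms; what remains is a
      polynomial identity in \<open>a\<close>, \<open>b\<close>, \<open>c\<close>, \<open>K\<close>
      and \<open>M\<close>.\<close>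
    define X where "X = P * Q * R * (1 + a - b - c + M) /
      ((1 + M) * F * B * C * (1 + a - b + M) * (1 + a - c + M))"
    have "(1 + a - b + K) * (1 + a - c + K) * (- (K + 1)) * (a + K + 1 + M) -
        (b + K) * (c + K) * (M - K) * (a + K) +
        (2 * K + 1 + a) * ((1 + M) * (1 + a - b + M) * (1 + a - c + M)) =
        (2 * K + 1 + a) * (M - K) * (a + K + 1 + M) * (1 + a - b - c + (M + 1))"
      by algebra
    hence "X * ((1 + a - b + K) * (1 + a - c + K) * (- (K + 1)) * (a + K + 1 + M) -
        (b + K) * (c + K) * (M - K) * (a + K) +
        (2 * K + 1 + a) * ((1 + M) * (1 + a - b + M) * (1 + a - c + M))) =
        X * ((2 * K + 1 + a) * (M - K) * (a + K + 1 + M) * (1 + a - b - c + (M + 1)))"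
      by simp
    moreover have "(1 + a - b + K) * (1 + a - c + K) *
        ((- (K + 1) * P) * (Q * (a + K + 1 + M)) * (R * (1 + a - b - c + M)) /
        ((1 + M) * F * (B * (1 + a - b + M)) * (C * (1 + a - c + M)))) =
        X * ((1 + a - b + K) * (1 + a - c + K) * (- (K + 1)) * (a + K + 1 + M))"
      by (simp only: X_def times_divide_eq_left times_divide_eq_right ac_simps)
    moreover have "(b + K) * (c + K) *
        (P * (M - K) * ((a + K) * Q) * (R * (1 + a - b - c + M)) /
        ((1 + M) * F * (B * (1 + a - b + M)) * (C * (1 + a - c + M)))) =
        X * ((b + K) * (c + K) * (M - K) * (a + K))"
      by (simp only: X_def times_divide_eq_left times_divide_eq_right ac_simps)
    moreover have "(2 * K + 1 + a) * P * Q * (R * (1 + a - b - c + M)) / (F * B * C) =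
        X * ((2 * K + 1 + a) * ((1 + M) * (1 + a - b + M) * (1 + a - c + M)))"
      using nz unfolding X_def by (simp add: divide_simps)
    moreover have "(2 * K + 1 + a) * (P * (M - K)) * (Q * (a + K + 1 + M)) *
       (R * (1 + a - b - c + M) * (1 + a - b - c + (M + 1))) /
       ((1 + M) * F * (B * (1 + a - b + M)) * (C * (1 + a - c + M))) =
       X * ((2 * K + 1 + a) * (M - K) * (a + K + 1 + M) * (1 + a - b - c + (M + 1)))"
      by (simp only: X_def times_divide_eq_left times_divide_eq_right ac_simps)
    ultimately show ?thesis by (simp only: ring_distribs)
  qed
  have 7: "pochhammer (1 + a - b) (Suc m) = B * (1 + a - b + M)"
    "pochhammer (1 + a - c) (Suc m) = C * (1 + a - c + M)"
    "pochhammer (1 + a - b - c) (Suc m) = R * (1 + a - b - c + M)"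
    "pochhammer (1 + a - b - c) (Suc (Suc m)) = R * (1 + a - b - c + M) * (1 + a - b - c + (M + 1))"
    by (simp_all add: pochhammer_Suc B_def C_def R_def M_def algebra_simps)
  have 8: "pochhammer (- of_nat k) m = P" "pochhammer (a + of_nat k + 1) m = Q"
    "pochhammer (1 + a - b) m = B" "pochhammer (1 + a - c) m = C" "fact m = F" "of_nat k = K"
    by (simp_all add: P_def Q_def B_def C_def F_def K_def)
  show ?case
    unfolding sum.atMost_Suc Suc.IH unfolding f_def 1 2 3 4 5 6 7 unfolding 8 unfolding P_def[symmetric] Q_def[symmetric]
    by (rule trans[OF add.commute eq])
qed

text \<open>Both sides satisfy the same first-order recurrence in \<open>k\<close>. The recurrence
  for the left side is the partial sum above at \<open>m = k + 1\<close>, where the factor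
  \<open>(-k)_(k+1)\<close> vanishes. This is the balanced 3F2 at 1 with upper parameters
  \<open>-k\<close>, \<open>a + k\<close>, \<open>1 + a - b - c\<close>.\<close>

lemma saalschuetz:
  fixes a b c :: "'a::field_char_0" and k :: nat
  assumes b: "\<And>l. 1 + a - b + of_nat l \<noteq> 0" and c: "\<And>l. 1 + a - c + of_nat l \<noteq> 0"
  shows "(\<Sum>j\<le>k. pochhammer (- of_nat k) j * pochhammer (a + of_nat k) j *
      pochhammer (1 + a - b - c) j /
      (fact j * pochhammer (1 + a - b) j * pochhammer (1 + a - c) j)) =
    pochhammer b k * pochhammer c k / (pochhammer (1 + a - b) k * pochhammer (1 + a - c) k)"
proof (induction k)
  case (Suc k)
  define f where "f = (\<lambda>k j. pochhammer (- of_nat k) j * pochhammer (a + of_nat k) j *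
      pochhammer (1 + a - b - c) j /
      (fact j * pochhammer (1 + a - b) j * pochhammer (1 + a - c) j))"
  have z: "pochhammer (- of_nat k :: 'a) (Suc k) = 0"
    by (simp add: pochhammer_of_nat_eq_0_iff)
  have "(\<Sum>j\<le>Suc k. (1 + a - b + of_nat k) * (1 + a - c + of_nat k) * f (Suc k) j -
            (b + of_nat k) * (c + of_nat k) * f k j) = 0"
    unfolding f_def by (subst saalschuetz_partial[OF b c]) (simp only: z mult_zero_left mult_zero_right div_0)
  moreover have "(\<Sum>j\<le>Suc k. f k j) = (\<Sum>j\<le>k. f k j)"
    by (simp add: f_def pochhammer_of_nat_eq_0_iff)
  ultimately have "(1 + a - b + of_nat k) * (1 + a - c + of_nat k) * (\<Sum>j\<le>Suc k. f (Suc k) j) =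
      (b + of_nat k) * (c + of_nat k) * (\<Sum>j\<le>k. f k j)"
    by (simp add: sum_subtractf sum_distrib_left[symmetric])
  hence "(\<Sum>j\<le>Suc k. f (Suc k) j) = (b + of_nat k) * (c + of_nat k) * (\<Sum>j\<le>k. f k j) /
      ((1 + a - b + of_nat k) * (1 + a - c + of_nat k))"
    using b[of k] c[of k] by (metis mult_eq_0_iff nonzero_mult_div_cancel_left)
  thus ?case
    using Suc by (simp add: f_def pochhammer_Suc mult_ac)
qed simp

section \<open>The terminating very well-poised 5F4 sum\<close>

text \<open>Creative telescoping in \<open>N\<close>, again with the certificate summed up to an
  arbitrary \<open>m\<close>. If \<delta> and \<epsilon> are the parameters with sum
  \<open>s\<close> and product \<open>q\<close>, then \<open>d l\<close> is
  \<open>(\<delta> + l)(\<epsilon> + l)\<close> and \<open>e l\<close> is the product of the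
  partners \<open>1 + a - \<delta> + l\<close> and \<open>1 + a - \<epsilon> + l\<close>. The factor
  \<open>a + 2 i\<close> is \<open>a\<close> times \<open>(1 + a/2)_i / (a/2)_i\<close>, written
  without division by \<open>a\<close>.\<close>

lemma well_poised_5F4_partial:
  fixes a s q :: "'a::field_char_0" and N m :: nat
  defines "d \<equiv> \<lambda>l::nat. of_nat l ^ 2 + s * of_nat l + q"
  defines "e \<equiv> \<lambda>l::nat. (a + of_nat l + 1) ^ 2 - s * (a + of_nat l + 1) + q"
  assumes a: "\<And>l. 0 < l \<Longrightarrow> a + of_nat l \<noteq> 0" and e: "\<And>l. e l \<noteq> 0"
  defines "f \<equiv> \<lambda>N i. (a + 2 * of_nat i) * pochhammer a i * pochhammer (- of_nat N) i * prod d {..<i} /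
      (fact i * pochhammer (1 + a + of_nat N) i * prod e {..<i})"
  shows "(\<Sum>i\<le>m. e N * f (Suc N) i - (a + of_nat N + 1) * (1 + a - s + of_nat N) * f N i) =
     (a + of_nat N + 1) * pochhammer a (Suc m) * pochhammer (- of_nat N) m * prod d {..<Suc m} /
       (fact m * pochhammer (1 + a + of_nat N) (Suc m) * prod e {..<m})"
proof (induction m)
  case 0
  have "a + of_nat N + 1 \<noteq> 0" using a[of "Suc N"] by (simp add: add_ac)
  thus ?case
    by (simp add: f_def d_def e_def power2_eq_square add_ac) (simp add: algebra_simps)
next
  case (Suc m)
  define K :: 'a where "K = of_nat N"
  define M :: 'a where "M = of_nat m"
  define A where "A = pochhammer a m"
  define P where "P = pochhammer (- K) m"
  define Q where "Q = pochhammer (1 + a + K) (Suc m)"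
  define D where "D = prod d {..<m}"
  define E where "E = prod e {..<m}"
  define F :: 'a where "F = fact m"
  have "a + of_nat (N + m + 2) \<noteq> 0" "a + of_nat (N + 1) \<noteq> 0"
    by (intro a; simp)+
  hence n1: "1 + a + K + 1 + M \<noteq> 0" and n2: "1 + a + K \<noteq> 0"
    by (simp_all add: K_def M_def algebra_simps)
  have n3: "Q \<noteq> 0"
  proof
    assume "Q = 0"
    then obtain l where "1 + a + K = - of_nat l"
      by (auto simp: Q_def pochhammer_eq_0_iff)
    hence "a + of_nat (N + l + 1) = 0"
      by (simp add: K_def eq_neg_iff_add_eq_0 add_ac)
    thus False using a[of "N + l + 1"] by simp
  qed
  have nz: "E \<noteq> 0" "F \<noteq> 0" "1 + M \<noteq> 0" "e m \<noteq> 0"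
    using e by (auto simp: E_def F_def M_def) (metis of_nat_Suc of_nat_eq_0_iff nat.distinct(1))
  have 1: "pochhammer (- of_nat (Suc N)) (Suc m) = - (K + 1) * P"
    by (simp add: pochhammer_rec K_def P_def algebra_simps)
  \<comment> \<open>The symbol based at \<open>N + 1\<close> is traded for the one based at
    \<open>N\<close>, so that both summands have \<open>Q\<close> in the denominator.\<close>
  have "pochhammer (1 + a + K) (Suc (Suc m)) = (1 + a + K) * pochhammer (1 + a + of_nat (Suc N)) (Suc m)"
    by (subst pochhammer_rec) (simp add: K_def algebra_simps)
  moreover have 3: "pochhammer (1 + a + K) (Suc (Suc m)) = Q * (1 + a + K + 1 + M)"
    by (subst pochhammer_Suc) (simp add: Q_def M_def algebra_simps)
  ultimately have 2: "pochhammer (1 + a + of_nat (Suc N)) (Suc m) = Q * (1 + a + K + 1 + M) / (1 + a + K)"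
    using n2 by (simp add: field_simps)
  have 4: "pochhammer (- of_nat N) (Suc m) = P * (M - K)"
    by (simp add: pochhammer_Suc K_def P_def M_def algebra_simps)
  have 5: "pochhammer a (Suc m) = A * (a + M)" "pochhammer a (Suc (Suc m)) = A * (a + M) * (a + M + 1)"
    by (simp_all add: pochhammer_Suc A_def M_def algebra_simps)
  have 6: "fact (Suc m) = (1 + M) * F"
    by (simp add: F_def M_def)
  have 7: "prod d {..<Suc m} = D * d m" "prod d {..<Suc (Suc m)} = D * d m * d (Suc m)"
    "prod e {..<Suc m} = E * e m"
    by (simp_all add: D_def E_def)
  have dM: "d (Suc m) = (M + 1)^2 + s * (M + 1) + q" and eM: "e m = (a + M + 1)^2 - s * (a + M + 1) + q"
    and eN: "e N = (a + K + 1)^2 - s * (a + K + 1) + q"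
    by (simp_all add: d_def e_def M_def K_def algebra_simps)
  have eq: "e N * ((a + 2 * (M + 1)) * (A * (a + M)) * (- (K + 1) * P) * (D * d m) /
      ((1 + M) * F * (Q * (1 + a + K + 1 + M) / (1 + a + K)) * (E * e m))) -
      (a + K + 1) * (1 + a - s + K) * ((a + 2 * (M + 1)) * (A * (a + M)) * (P * (M - K)) * (D * d m) /
      ((1 + M) * F * Q * (E * e m))) +
      (a + K + 1) * (A * (a + M)) * P * (D * d m) / (F * Q * E) =
      (a + K + 1) * (A * (a + M) * (a + M + 1)) * (P * (M - K)) * (D * d m * d (Suc m)) /
      ((1 + M) * F * (Q * (1 + a + K + 1 + M)) * (E * e m))"
  proof -
    define X where "X = (a + K + 1) * A * (a + M) * P * D * d m / ((1 + M) * F * Q * E * e m * (1 + a + K + 1 + M))"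
    have "e N * (a + 2 * (M + 1)) * (- (K + 1)) - (1 + a - s + K) * (a + 2 * (M + 1)) * (M - K) * (1 + a + K + 1 + M)
      + (1 + M) * e m * (1 + a + K + 1 + M) = (a + M + 1) * (M - K) * d (Suc m)"
      unfolding dM eM eN by algebra
    hence "X * (e N * (a + 2 * (M + 1)) * (- (K + 1)) - (1 + a - s + K) * (a + 2 * (M + 1)) * (M - K) * (1 + a + K + 1 + M)
      + (1 + M) * e m * (1 + a + K + 1 + M)) = X * ((a + M + 1) * (M - K) * d (Suc m))"
      by simp
    moreover have "e N * ((a + 2 * (M + 1)) * (A * (a + M)) * (- (K + 1) * P) * (D * d m) /
      ((1 + M) * F * (Q * (1 + a + K + 1 + M) / (1 + a + K)) * (E * e m))) = X * (e N * (a + 2 * (M + 1)) * (- (K + 1)))"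
      using nz n1 n2 n3 unfolding X_def by (simp add: field_simps)
    moreover have "(a + K + 1) * (1 + a - s + K) * ((a + 2 * (M + 1)) * (A * (a + M)) * (P * (M - K)) * (D * d m) /
      ((1 + M) * F * Q * (E * e m))) = X * ((1 + a - s + K) * (a + 2 * (M + 1)) * (M - K) * (1 + a + K + 1 + M))"
      using nz n1 n2 n3 unfolding X_def by (simp add: divide_simps)
    moreover have "(a + K + 1) * (A * (a + M)) * P * (D * d m) / (F * Q * E) = X * ((1 + M) * e m * (1 + a + K + 1 + M))"
      using nz n1 n2 n3 unfolding X_def by (simp add: divide_simps)
    moreover have "(a + K + 1) * (A * (a + M) * (a + M + 1)) * (P * (M - K)) * (D * d m * d (Suc m)) /
      ((1 + M) * F * (Q * (1 + a + K + 1 + M)) * (E * e m)) = X * ((a + M + 1) * (M - K) * d (Suc m))"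
      using nz n1 n2 n3 unfolding X_def by (simp add: divide_simps)
    ultimately show ?thesis by (simp only: ring_distribs)
  qed
  have 8: "pochhammer (1 + a + of_nat N) (Suc m) = Q" "pochhammer (1 + a + of_nat N) (Suc (Suc m)) = Q * (1 + a + K + 1 + M)"
    using 3 by (simp_all add: Q_def K_def)
  have 9: "pochhammer (- of_nat N) m = P" "prod e {..<m} = E" "fact m = F" "of_nat N = K" "of_nat (Suc m) = M + 1"
    by (simp_all add: P_def E_def F_def K_def M_def)
  show ?case
    unfolding sum.atMost_Suc Suc.IH unfolding f_def 1 2 4 5 6 7 8 unfolding 9 unfolding P_def[symmetric]
    by (rule trans[OF add.commute eq])
qed

text \<open>At \<open>m = N + 1\<close> the certificate contains \<open>(-N)_(N+1) = 0\<close>,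
  which leaves a first-order recurrence in \<open>N\<close> that the product on the right also
  satisfies.\<close>

lemma well_poised_5F4:
  fixes a s q :: "'a::field_char_0" and N :: nat
  defines "d \<equiv> \<lambda>l::nat. of_nat l ^ 2 + s * of_nat l + q"
  defines "e \<equiv> \<lambda>l::nat. (a + of_nat l + 1) ^ 2 - s * (a + of_nat l + 1) + q"
  assumes a: "\<And>l. 0 < l \<Longrightarrow> a + of_nat l \<noteq> 0" and e: "\<And>l. e l \<noteq> 0"
  shows "(\<Sum>i\<le>N. (a + 2 * of_nat i) * pochhammer a i * pochhammer (- of_nat N) i * prod d {..<i} /
      (fact i * pochhammer (1 + a + of_nat N) i * prod e {..<i})) =
    pochhammer a (Suc N) * pochhammer (1 + a - s) N / prod e {..<N}"
proof (induction N)
  case (Suc N)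
  define f where "f = (\<lambda>N i. (a + 2 * of_nat i) * pochhammer a i * pochhammer (- of_nat N) i * prod d {..<i} /
      (fact i * pochhammer (1 + a + of_nat N) i * prod e {..<i}))"
  have z: "pochhammer (- of_nat N :: 'a) (Suc N) = 0"
    by (simp add: pochhammer_of_nat_eq_0_iff)
  have "(\<Sum>i\<le>Suc N. e N * f (Suc N) i - (a + of_nat N + 1) * (1 + a - s + of_nat N) * f N i) = 0"
    unfolding f_def d_def e_def
    by (subst well_poised_5F4_partial[OF a e[unfolded e_def]])
      (simp_all only: z mult_zero_left mult_zero_right div_0 not_False_eq_True)
  moreover have "(\<Sum>i\<le>Suc N. f N i) = (\<Sum>i\<le>N. f N i)"
    by (simp add: f_def pochhammer_of_nat_eq_0_iff)
  ultimately have "e N * (\<Sum>i\<le>Suc N. f (Suc N) i) =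
      (a + of_nat N + 1) * (1 + a - s + of_nat N) * (\<Sum>i\<le>N. f N i)"
    by (simp add: sum_subtractf sum_distrib_left[symmetric])
  hence "(\<Sum>i\<le>Suc N. f (Suc N) i) = (a + of_nat N + 1) * (1 + a - s + of_nat N) * (\<Sum>i\<le>N. f N i) / e N"
    using e[of N] by (metis nonzero_mult_div_cancel_left)
  also have "(\<Sum>i\<le>N. f N i) = pochhammer a (Suc N) * pochhammer (1 + a - s) N / prod e {..<N}"
    using Suc by (simp add: f_def)
  finally show ?case
    by (simp add: f_def pochhammer_Suc[of _ "Suc N"] pochhammer_Suc[of "1 + a - s"] mult_ac add_ac)
qed simp

section \<open>Exchanging the two summations\<close>

lemma prod_lessThan_add:
  fixes g :: "nat \<Rightarrow> 'a::comm_monoid_mult"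
  shows "prod g {..<j + i} = prod g {..<j} * (\<Prod>l<i. g (j + l))"
  by (induction i) (simp_all add: mult_ac)

text \<open>For \<open>k = j + i\<close> the factor \<open>(-k)_j\<close> of the Saalschuetz summand
  cancels the top \<open>j\<close> factors of \<open>k!\<close>; only \<open>i!\<close> is left for
  the inner sum.\<close>

lemma fact_shifted:
  "pochhammer (- of_nat (j + i)) j / fact (j + i) = ((- 1) ^ j / fact i :: 'a::field_char_0)"
proof -
  have "pochhammer (- of_nat (j + i) :: 'a) j = (- 1) ^ j * pochhammer (1 + of_nat i) j"
    using pochhammer_minus[of "of_nat (j + i) :: 'a" j] by (simp add: add_ac)
  moreover have "fact (j + i) = (fact i * pochhammer (1 + of_nat i) j :: 'a)"
    by (metis add.commute pochhammer_fact pochhammer_product')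
  ultimately show ?thesis
    by (simp add: pochhammer_eq_0_iff eq_neg_iff_add_eq_0 divide_simps)
      (metis of_nat_0_eq_iff of_nat_Suc of_nat_add add.assoc add.commute add_Suc nat.distinct(1))
qed

text \<open>Shifting \<open>k = j + i\<close> moves the two parameters behind \<open>s\<close> and
  \<open>q\<close> up by \<open>j\<close> each and \<open>a\<close> up by \<open>2 j\<close>.
  Well-poisedness survives this shift, so that apart from a factor depending on \<open>j\<close>
  alone the summand is again one of the 5F4 sum, now of length \<open>n - j\<close>.\<close>

lemma whipple_summand:
  fixes a b c s q :: "'a::field_char_0" and j i n :: nat
  defines "d \<equiv> \<lambda>l::nat. of_nat l ^ 2 + s * of_nat l + q"
  defines "e \<equiv> \<lambda>l::nat. (a + of_nat l + 1) ^ 2 - s * (a + of_nat l + 1) + q"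
  assumes "j \<le> n"
  defines "d' \<equiv> \<lambda>l::nat. of_nat l ^ 2 + (s + 2 * of_nat j) * of_nat l + (of_nat j ^ 2 + s * of_nat j + q)"
  defines "a' \<equiv> a + 2 * of_nat j"
  defines "e' \<equiv> \<lambda>l::nat. (a' + of_nat l + 1) ^ 2 - (s + 2 * of_nat j) * (a' + of_nat l + 1)
      + (of_nat j ^ 2 + s * of_nat j + q)"
  shows "(a + 2 * of_nat (j + i)) * pochhammer a (j + i) * pochhammer (- of_nat n) (j + i) * prod d {..<j + i} /
      (fact (j + i) * pochhammer (1 + a + of_nat n) (j + i) * prod e {..<j + i}) *
      (pochhammer (- of_nat (j + i)) j * pochhammer (a + of_nat (j + i)) j) =
    (- 1) ^ j * pochhammer a (2 * j) * pochhammer (- of_nat n) j * prod d {..<j} /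
      (pochhammer (1 + a + of_nat n) j * prod e {..<j}) *
    ((a' + 2 * of_nat i) * pochhammer a' i * pochhammer (- of_nat (n - j)) i * prod d' {..<i} /
      (fact i * pochhammer (1 + a' + of_nat (n - j)) i * prod e' {..<i}))"
proof -
  have d: "prod d {..<j + i} = prod d {..<j} * prod d' {..<i}"
    unfolding prod_lessThan_add d'_def d_def
    by (intro arg_cong2[where f = "(*)"] prod.cong refl) (simp add: power2_eq_square algebra_simps)
  have e: "prod e {..<j + i} = prod e {..<j} * prod e' {..<i}"
    unfolding prod_lessThan_add e'_def e_def a'_def
    by (intro arg_cong2[where f = "(*)"] prod.cong refl) (simp add: power2_eq_square algebra_simps)
  \<comment> \<open>The two symbols are adjacent runs starting at \<open>a\<close>; their union, of
    length \<open>2 j + i\<close>, is cut again after \<open>2 j\<close> factors.\<close>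
  have "pochhammer a (j + i) * pochhammer (a + of_nat (j + i)) j = pochhammer a (2 * j + i)"
    using pochhammer_product'[of a "j + i" j] by (simp add: mult_2 add_ac)
  hence a: "pochhammer a (j + i) * pochhammer (a + of_nat (j + i)) j = pochhammer a (2 * j) * pochhammer a' i"
    by (simp add: pochhammer_product' a'_def)
  have n: "pochhammer (- of_nat n :: 'a) (j + i) = pochhammer (- of_nat n) j * pochhammer (- of_nat (n - j)) i"
    using \<open>j \<le> n\<close> by (simp add: pochhammer_product' of_nat_diff)
  have "1 + a' + of_nat (n - j) = 1 + a + of_nat n + of_nat j"
    using \<open>j \<le> n\<close> by (simp add: of_nat_diff a'_def)
  hence m: "pochhammer (1 + a + of_nat n) (j + i) =
      pochhammer (1 + a + of_nat n) j * pochhammer (1 + a' + of_nat (n - j)) i"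
    by (simp only: pochhammer_product')
  have aj: "a + 2 * of_nat (j + i) = a' + 2 * of_nat i"
    by (simp add: a'_def algebra_simps)
  have "(a + 2 * of_nat (j + i)) * pochhammer a (j + i) * pochhammer (- of_nat n) (j + i) * prod d {..<j + i} /
      (fact (j + i) * pochhammer (1 + a + of_nat n) (j + i) * prod e {..<j + i}) *
      (pochhammer (- of_nat (j + i)) j * pochhammer (a + of_nat (j + i)) j) =
    (a + 2 * of_nat (j + i)) * (pochhammer a (j + i) * pochhammer (a + of_nat (j + i)) j) *
      pochhammer (- of_nat n) (j + i) * prod d {..<j + i} *
      (pochhammer (- of_nat (j + i)) j / fact (j + i)) /
      (pochhammer (1 + a + of_nat n) (j + i) * prod e {..<j + i})"
    by (simp only: times_divide_eq_left times_divide_eq_right divide_divide_eq_left ac_simps)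
  also have "\<dots> = (- 1) ^ j * pochhammer a (2 * j) * pochhammer (- of_nat n) j * prod d {..<j} /
      (pochhammer (1 + a + of_nat n) j * prod e {..<j}) *
    ((a' + 2 * of_nat i) * pochhammer a' i * pochhammer (- of_nat (n - j)) i * prod d' {..<i} /
      (fact i * pochhammer (1 + a' + of_nat (n - j)) i * prod e' {..<i}))"
    unfolding a fact_shifted n m d e aj
    by (simp only: times_divide_eq_left times_divide_eq_right divide_divide_eq_left
        times_divide_times_eq ac_simps)
  finally show ?thesis .
qed

text \<open>The parameters \<open>d, e\<close> of Whipple's transformation enter only through \<open>s = d + e\<close> and
  \<open>q = d e\<close>, so that they need not lie in the field themselves.\<close>

theorem whipple:
  fixes a b c s q :: "'a::field_char_0" and n :: nat
  defines "d \<equiv> \<lambda>l::nat. of_nat l ^ 2 + s * of_nat l + q"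
  defines "e \<equiv> \<lambda>l::nat. (a + of_nat l + 1) ^ 2 - s * (a + of_nat l + 1) + q"
  assumes a: "\<And>l. 0 < l \<Longrightarrow> a + of_nat l \<noteq> 0" and e: "\<And>l. e l \<noteq> 0"
    and b: "\<And>l. 1 + a - b + of_nat l \<noteq> 0" and c: "\<And>l. 1 + a - c + of_nat l \<noteq> 0"
  shows "(\<Sum>k\<le>n. (a + 2 * of_nat k) * pochhammer a k * pochhammer (- of_nat n) k * prod d {..<k} /
        (fact k * pochhammer (1 + a + of_nat n) k * prod e {..<k}) *
        (pochhammer b k * pochhammer c k / (pochhammer (1 + a - b) k * pochhammer (1 + a - c) k))) =
    (\<Sum>j\<le>n. (- 1) ^ j * pochhammer (1 + a - b - c) j * pochhammer (- of_nat n) j *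
        pochhammer a (Suc (n + j)) * pochhammer (1 + a - s) (n - j) * prod d {..<j} /
        (fact j * pochhammer (1 + a - b) j * pochhammer (1 + a - c) j *
          pochhammer (1 + a + of_nat n) j)) / prod e {..<n}"
proof -
  define f where "f = (\<lambda>k. (a + 2 * of_nat k) * pochhammer a k * pochhammer (- of_nat n) k * prod d {..<k} /
        (fact k * pochhammer (1 + a + of_nat n) k * prod e {..<k}))"
  define g where "g = (\<lambda>j. pochhammer (1 + a - b - c) j /
      (fact j * pochhammer (1 + a - b) j * pochhammer (1 + a - c) j))"
  define h where "h = (\<lambda>k j. f k * (pochhammer (- of_nat k) j * pochhammer (a + of_nat k) j) * g j)"
  \<comment> \<open>Saalschuetz's formula is read from right to left: after expansion,
    \<open>b\<close> and \<open>c\<close> occur only in \<open>g j\<close>, which does not depend on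
    \<open>k\<close>.\<close>
  have 1: "f k * (pochhammer b k * pochhammer c k / (pochhammer (1 + a - b) k * pochhammer (1 + a - c) k)) =
      (\<Sum>j\<le>k. h k j)" for k
    unfolding saalschuetz[OF b c, symmetric] h_def g_def sum_distrib_left
    by (simp add: mult_ac)
  have 2: "(\<Sum>i\<le>n - j. h (j + i) j) = (- 1) ^ j * pochhammer (1 + a - b - c) j * pochhammer (- of_nat n) j *
        pochhammer a (Suc (n + j)) * pochhammer (1 + a - s) (n - j) * prod d {..<j} /
        (fact j * pochhammer (1 + a - b) j * pochhammer (1 + a - c) j *
          pochhammer (1 + a + of_nat n) j) / prod e {..<n}" if "j \<le> n" for j
  proof -
    define a' where "a' = a + 2 * of_nat j"
    define s' where "s' = s + 2 * of_nat j"
    define q' where "q' = of_nat j ^ 2 + s * of_nat j + q"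
    define d' where "d' = (\<lambda>l::nat. of_nat l ^ 2 + s' * of_nat l + q')"
    define e' where "e' = (\<lambda>l::nat. (a' + of_nat l + 1) ^ 2 - s' * (a' + of_nat l + 1) + q')"
    define C where "C = (- 1) ^ j * pochhammer a (2 * j) * pochhammer (- of_nat n) j * prod d {..<j} /
      (pochhammer (1 + a + of_nat n) j * prod e {..<j})"
    have e'e: "e' l = e (j + l)" for l
      by (simp add: e'_def e_def a'_def s'_def q'_def power2_eq_square algebra_simps)
    have a'nz: "a' + of_nat l \<noteq> 0" if "0 < l" for l
      using a[of "2 * j + l"] that by (simp add: a'_def add_ac)
    have "h (j + i) j = C * g j * ((a' + 2 * of_nat i) * pochhammer a' i * pochhammer (- of_nat (n - j)) i *
        prod d' {..<i} / (fact i * pochhammer (1 + a' + of_nat (n - j)) i * prod e' {..<i}))" for i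
      using whipple_summand[OF that, of a i s q]
      unfolding h_def f_def C_def d_def e_def d'_def e'_def a'_def s'_def q'_def
      by (simp only: mult_ac)
    hence "(\<Sum>i\<le>n - j. h (j + i) j) = C * g j * (\<Sum>i\<le>n - j. (a' + 2 * of_nat i) * pochhammer a' i *
        pochhammer (- of_nat (n - j)) i * prod d' {..<i} /
        (fact i * pochhammer (1 + a' + of_nat (n - j)) i * prod e' {..<i}))"
      by (simp only: sum_distrib_left)
    also have "\<dots> = C * g j * (pochhammer a' (Suc (n - j)) * pochhammer (1 + a' - s') (n - j) / prod e' {..<n - j})"
      unfolding d'_def e'_def
      by (subst well_poised_5F4[OF a'nz]) (use e'e e in \<open>auto simp: e'_def\<close>)
    \<comment> \<open>The shifts by \<open>2 j\<close> cancel, so the base of this symbol is the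
      same for all \<open>j\<close>.\<close>
    also have "1 + a' - s' = 1 + a - s"
      by (simp add: a'_def s'_def)
    also have "C * g j * (pochhammer a' (Suc (n - j)) * pochhammer (1 + a - s) (n - j) / prod e' {..<n - j}) =
       (- 1) ^ j * pochhammer (1 + a - b - c) j * pochhammer (- of_nat n) j *
        (pochhammer a (2 * j) * pochhammer a' (Suc (n - j))) * pochhammer (1 + a - s) (n - j) * prod d {..<j} /
        (fact j * pochhammer (1 + a - b) j * pochhammer (1 + a - c) j *
          pochhammer (1 + a + of_nat n) j * (prod e {..<j} * prod e' {..<n - j}))"
      by (simp only: C_def g_def times_divide_eq_left times_divide_eq_right divide_divide_eq_left
        times_divide_times_eq ac_simps)
    also have "pochhammer a (2 * j) * pochhammer a' (Suc (n - j)) = pochhammer a (Suc (n + j))"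
      using pochhammer_product'[of a "2 * j" "Suc (n - j)"] that by (simp add: a'_def add.commute)
    also have "prod e {..<j} * prod e' {..<n - j} = prod e {..<n}"
      using prod_lessThan_add[of e j "n - j"] that by (simp add: e'e)
    finally show ?thesis by (simp only: divide_divide_eq_left mult.assoc)
  qed
  \<comment> \<open>The triangle \<open>j \<le> k \<le> n\<close> is summed by columns, with
    \<open>k = j + i\<close>.\<close>
  have "(\<Sum>k\<le>n. \<Sum>j\<le>k. h k j) = (\<Sum>j\<le>n. \<Sum>i\<le>n - j. h (j + i) j)"
    unfolding sum.Sigma[OF finite_atMost ballI[OF finite_atMost]]
    by (rule sum.reindex_bij_witness[of _ "\<lambda>(j, i). (j + i, j)" "\<lambda>(k, j). (j, k - j)"]) auto
  with 1 2 show ?thesis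
    by (simp add: f_def sum_divide_distrib)
qed

section \<open>Divisibility by powers of a prime in the rationals\<close>

text \<open>This is the ideal generated by \<open>p^m\<close> in the localization of the integers at
  p. The case \<open>m = 0\<close> is the ring of p-integral rationals itself, so integrality and
  divisibility share one set of closure rules.\<close>

definition padic_ideal :: "nat \<Rightarrow> nat \<Rightarrow> rat set" where
  "padic_ideal p m = {x. rat_cong_pow x 0 p m}"

definition padic_unit :: "nat \<Rightarrow> rat \<Rightarrow> bool" where
  "padic_unit p u \<longleftrightarrow> (\<exists>a b::int. \<not> int p dvd a \<and> \<not> int p dvd b \<and> u = of_int a / of_int b)"

lemma padic_ideal_iff:
  "x \<in> padic_ideal p m \<longleftrightarrow>
    (\<exists>a b::int. \<not> int p dvd b \<and> x = of_nat p ^ m * of_int a / of_int b)"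
  unfolding padic_ideal_def rat_cong_pow_def by (simp flip: times_divide_eq_right) (metis dvd_0_right)

context
  fixes p :: nat
  assumes p: "prime p"
begin

lemma not_dvd_mult: "\<not> int p dvd a \<Longrightarrow> \<not> int p dvd b \<Longrightarrow> \<not> int p dvd a * b"
  using p by (simp add: prime_dvd_mult_iff)

lemma not_dvd_imp_nonzero: "\<not> int p dvd b \<Longrightarrow> (of_int b :: rat) \<noteq> 0"
  by auto

lemma padic_ideal_mult:
  assumes "x \<in> padic_ideal p m" "y \<in> padic_ideal p k"
  shows "x * y \<in> padic_ideal p (m + k)"
proof -
  obtain a b where 1: "\<not> int p dvd b" "x = of_nat p ^ m * of_int a / of_int b"
    using assms by (auto simp: padic_ideal_iff)
  obtain c d where 2: "\<not> int p dvd d" "y = of_nat p ^ k * of_int c / of_int d"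
    using assms by (auto simp: padic_ideal_iff)
  have "x * y = of_nat p ^ (m + k) * of_int (a * c) / of_int (b * d)"
    unfolding 1 2 by (simp add: power_add)
  with 1 2 show ?thesis
    unfolding padic_ideal_iff using not_dvd_mult by blast
qed

lemma padic_ideal_add:
  assumes "x \<in> padic_ideal p m" "y \<in> padic_ideal p m"
  shows "x + y \<in> padic_ideal p m"
proof -
  obtain a b where 1: "\<not> int p dvd b" "x = of_nat p ^ m * of_int a / of_int b"
    using assms by (auto simp: padic_ideal_iff)
  obtain c d where 2: "\<not> int p dvd d" "y = of_nat p ^ m * of_int c / of_int d"
    using assms by (auto simp: padic_ideal_iff)
  have "x + y = of_nat p ^ m * of_int (a * d + c * b) / of_int (b * d)"
    unfolding 1 2 using not_dvd_imp_nonzero[OF 1(1)] not_dvd_imp_nonzero[OF 2(1)]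
    by (simp add: field_simps)
  with 1 2 show ?thesis
    unfolding padic_ideal_iff using not_dvd_mult by blast
qed

lemma padic_ideal_of_int [simp]: "of_int a \<in> padic_ideal p 0"
  unfolding padic_ideal_iff
  by (rule exI[of _ a], rule exI[of _ 1]) (use prime_gt_1_nat[OF p] in auto)

lemma padic_ideal_simps [simp]:
  "0 \<in> padic_ideal p 0" "1 \<in> padic_ideal p 0" "numeral w \<in> padic_ideal p 0" "of_nat k \<in> padic_ideal p 0"
  using padic_ideal_of_int[of 0] padic_ideal_of_int[of 1] padic_ideal_of_int[of "numeral w"]
    padic_ideal_of_int[of "int k"] by simp_all

lemma padic_ideal_zero [simp]: "0 \<in> padic_ideal p m"
  unfolding padic_ideal_iff
  by (rule exI[of _ 0], rule exI[of _ 1]) (use prime_gt_1_nat[OF p] in auto)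

lemma padic_ideal_prime: "of_nat p \<in> padic_ideal p 1"
  unfolding padic_ideal_iff
  by (rule exI[of _ 1], rule exI[of _ 1]) (use prime_gt_1_nat[OF p] in auto)

lemma padic_ideal_mult_left: "x \<in> padic_ideal p 0 \<Longrightarrow> y \<in> padic_ideal p m \<Longrightarrow> x * y \<in> padic_ideal p m"
  using padic_ideal_mult[of x 0 y m] by simp

lemma padic_ideal_mult_right: "x \<in> padic_ideal p m \<Longrightarrow> y \<in> padic_ideal p 0 \<Longrightarrow> x * y \<in> padic_ideal p m"
  using padic_ideal_mult[of x m y 0] by simp

lemma padic_ideal_uminus: "x \<in> padic_ideal p m \<Longrightarrow> - x \<in> padic_ideal p m"
  using padic_ideal_mult_left[OF padic_ideal_of_int[of "- 1"], of x m] by simp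

lemma padic_ideal_diff: "x \<in> padic_ideal p m \<Longrightarrow> y \<in> padic_ideal p m \<Longrightarrow> x - y \<in> padic_ideal p m"
  using padic_ideal_add[of x m "- y"] by (simp add: padic_ideal_uminus)

lemma padic_ideal_mono:
  assumes "m \<le> k" "x \<in> padic_ideal p k"
  shows "x \<in> padic_ideal p m"
proof -
  obtain a b where ab: "\<not> int p dvd b" "x = of_nat p ^ k * of_int a / of_int b"
    using assms(2) by (auto simp: padic_ideal_iff)
  have "of_nat p ^ k = (of_nat p ^ m * of_nat p ^ (k - m) :: rat)"
    using assms(1) by (simp flip: power_add)
  hence "x = of_nat p ^ m * of_int (int p ^ (k - m) * a) / of_int b"
    by (simp add: ab)
  with ab show ?thesis unfolding padic_ideal_iff by blast
qed

lemma padic_ideal_integral: "x \<in> padic_ideal p m \<Longrightarrow> x \<in> padic_ideal p 0"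
  by (rule padic_ideal_mono[of 0 m]) simp_all

lemma padic_ideal_power: "x \<in> padic_ideal p m \<Longrightarrow> x ^ k \<in> padic_ideal p (m * k)"
  by (induction k) (auto dest: padic_ideal_mult)

lemma padic_ideal_sum: "(\<And>i. i \<in> A \<Longrightarrow> f i \<in> padic_ideal p m) \<Longrightarrow> sum f A \<in> padic_ideal p m"
  by (induction A rule: infinite_finite_induct) (auto intro: padic_ideal_add)

lemma padic_ideal_prod: "(\<And>i. i \<in> A \<Longrightarrow> f i \<in> padic_ideal p 0) \<Longrightarrow> prod f A \<in> padic_ideal p 0"
  by (induction A rule: infinite_finite_induct) (auto intro: padic_ideal_mult_left)

lemma padic_ideal_prod_factor:
  assumes "\<And>i. i \<in> A \<Longrightarrow> f i \<in> padic_ideal p 0" "finite A" "j \<in> A" "f j \<in> padic_ideal p m"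
  shows "prod f A \<in> padic_ideal p m"
  unfolding prod.remove[OF assms(2,3)]
  by (intro padic_ideal_mult_right padic_ideal_prod assms) (use assms in auto)

lemma padic_ideal_pochhammer: "x \<in> padic_ideal p 0 \<Longrightarrow> pochhammer x k \<in> padic_ideal p 0"
  unfolding pochhammer_prod by (intro padic_ideal_prod padic_ideal_add) auto

lemma padic_ideal_pochhammer_factor:
  assumes "x \<in> padic_ideal p 0" "l < k" "x + of_nat l \<in> padic_ideal p m"
  shows "pochhammer x k \<in> padic_ideal p m"
  unfolding pochhammer_prod
  by (rule padic_ideal_prod_factor[of _ _ l]) (use assms in \<open>auto intro: padic_ideal_add\<close>)

text \<open>The factors are exchanged one at a time, as in the product rule; integrality of the
  others preserves the error.\<close>

lemma padic_ideal_prod_diff: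
  assumes "\<And>i. i \<in> A \<Longrightarrow> f i \<in> padic_ideal p 0" "\<And>i. i \<in> A \<Longrightarrow> g i \<in> padic_ideal p 0"
    and "\<And>i. i \<in> A \<Longrightarrow> f i - g i \<in> padic_ideal p m"
  shows "prod f A - prod g A \<in> padic_ideal p m"
  using assms
proof (induction A rule: infinite_finite_induct)
  case (insert i A)
  have "prod f (insert i A) - prod g (insert i A) =
      f i * (prod f A - prod g A) + (f i - g i) * prod g A"
    using insert.hyps by (simp add: algebra_simps)
  thus ?case
    using insert by (auto intro!: padic_ideal_add intro: padic_ideal_mult_left padic_ideal_mult_right
        padic_ideal_prod)
qed auto

lemma padic_unit_integral: "padic_unit p u \<Longrightarrow> u \<in> padic_ideal p 0"
  unfolding padic_unit_def padic_ideal_iff by auto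

lemma padic_unit_nonzero: "padic_unit p u \<Longrightarrow> u \<noteq> 0"
  unfolding padic_unit_def by (auto simp: divide_eq_0_iff)

lemma padic_unit_of_int: "\<not> int p dvd a \<Longrightarrow> padic_unit p (of_int a)"
  unfolding padic_unit_def
  by (rule exI[of _ a], rule exI[of _ 1]) (use prime_gt_1_nat[OF p] in auto)

lemma padic_unit_mult: "padic_unit p u \<Longrightarrow> padic_unit p v \<Longrightarrow> padic_unit p (u * v)"
proof -
  assume "padic_unit p u" "padic_unit p v"
  then obtain a b c d where 1: "\<not> int p dvd a" "\<not> int p dvd b" "u = of_int a / of_int b"
    and 2: "\<not> int p dvd c" "\<not> int p dvd d" "v = of_int c / of_int d"
    unfolding padic_unit_def by blast
  have "u * v = of_int (a * c) / of_int (b * d)"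
    unfolding 1 2 by simp
  with 1 2 show ?thesis
    unfolding padic_unit_def using not_dvd_mult by blast
qed

lemma padic_unit_inverse: "padic_unit p u \<Longrightarrow> padic_unit p (inverse u)"
  unfolding padic_unit_def by (metis inverse_divide)

lemma padic_unit_divide: "padic_unit p u \<Longrightarrow> padic_unit p v \<Longrightarrow> padic_unit p (u / v)"
  by (simp add: divide_inverse padic_unit_mult padic_unit_inverse)

text \<open>The Whipple denominators have, up to a factor 1/2, the form integer plus or minus
  \<open>x\<close> with p dividing \<open>x\<close>; they are units as soon as the integer is prime
  to p.\<close>

lemma padic_unit_add:
  assumes "\<not> int p dvd a" "z \<in> padic_ideal p 1"
  shows "padic_unit p (of_int a + z)"
proof -
  obtain c d where 1: "\<not> int p dvd d" "z = of_nat p * of_int c / of_int d"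
    using assms by (auto simp: padic_ideal_iff)
  have "of_int a + z = of_int (a * d + int p * c) / of_int d"
    unfolding 1 using not_dvd_imp_nonzero[OF 1(1)] by (simp add: field_simps)
  moreover have "\<not> int p dvd a * d + int p * c"
    using not_dvd_mult[OF assms(1) 1(1)] by (simp add: dvd_add_left_iff)
  ultimately show ?thesis
    unfolding padic_unit_def using 1 by blast
qed

lemma padic_unit_prod: "(\<And>i. i \<in> A \<Longrightarrow> padic_unit p (f i)) \<Longrightarrow> padic_unit p (prod f A)"
  using padic_unit_of_int[of 1] prime_gt_1_nat[OF p]
  by (induction A rule: infinite_finite_induct) (auto intro: padic_unit_mult)

lemma padic_ideal_divide: "x \<in> padic_ideal p m \<Longrightarrow> padic_unit p u \<Longrightarrow> x / u \<in> padic_ideal p m"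
  unfolding divide_inverse by (blast intro: padic_ideal_mult_right padic_unit_integral padic_unit_inverse)

lemma padic_ideal_divide_diff:
  assumes "x - y \<in> padic_ideal p m" "u - v \<in> padic_ideal p m" "y \<in> padic_ideal p 0"
    and "padic_unit p u" "padic_unit p v"
  shows "x / u - y / v \<in> padic_ideal p m"
proof -
  have "x / u - y / v = ((x - y) * v - y * (u - v)) / (u * v)"
    using padic_unit_nonzero[OF assms(4)] padic_unit_nonzero[OF assms(5)] by (simp add: field_simps)
  also have "\<dots> \<in> padic_ideal p m"
    using assms by (intro padic_ideal_divide padic_ideal_diff padic_unit_mult)
      (auto intro: padic_ideal_mult_left padic_ideal_mult_right padic_unit_integral)
  finally show ?thesis .
qed

lemma not_dvd_small: "a \<noteq> 0 \<Longrightarrow> \<bar>a\<bar> < int p \<Longrightarrow> \<not> int p dvd a"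
  using zdvd_imp_le[of "int p" "\<bar>a\<bar>"] by auto

lemma padic_unit_fact:
  assumes "k < p"
  shows "padic_unit p (fact k)"
proof -
  have "padic_unit p (of_nat i)" if "i \<in> {1..k}" for i
    using padic_unit_of_int[OF not_dvd_small[of "int i"]] that assms by simp
  hence "padic_unit p (\<Prod>i\<in>{1..k}. of_nat i)"
    by (rule padic_unit_prod)
  thus ?thesis
    by (simp add: fact_prod)
qed

lemma padic_unit_pochhammer: "(\<And>l. l < k \<Longrightarrow> padic_unit p (x + of_nat l)) \<Longrightarrow> padic_unit p (pochhammer x k)"
  unfolding pochhammer_prod by (intro padic_unit_prod) auto

end

section \<open>The supercongruence\<close>

text \<open>The very well-poised summand with parameters \<open>a\<close>,
  \<open>a +- sqrt X\<close> and \<open>a +- sqrt t\<close>, whose partners are \<open>1\<close>,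
  \<open>1 -+ sqrt X\<close> and \<open>1 -+ sqrt t\<close>. Using the squares as arguments admits
  \<open>t = -x^2\<close>, which has no rational root.\<close>

definition wp_term :: "rat \<Rightarrow> rat \<Rightarrow> rat \<Rightarrow> nat \<Rightarrow> rat" where
  "wp_term a X t k = (a + 2 * of_nat k) * pochhammer a k *
     (\<Prod>l<k. ((a + of_nat l)\<^sup>2 - X) * ((a + of_nat l)\<^sup>2 - t)) /
     (fact k * (\<Prod>l<k. ((of_nat l + 1)\<^sup>2 - X) * ((of_nat l + 1)\<^sup>2 - t)))"

lemma wp_term_0_0: "wp_term a 0 0 k = (a + 2 * of_nat k) * pochhammer a k ^ 5 / fact k ^ 5"
proof -
  have "(\<Prod>l<k. ((a + of_nat l)\<^sup>2 - 0) * ((a + of_nat l)\<^sup>2 - 0)) = pochhammer a k ^ 4"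
    by (simp add: pochhammer_prod prod_power_distrib atLeast0LessThan flip: power_add)
  moreover have "(\<Prod>l<k. ((of_nat l + 1)\<^sup>2 - 0) * ((of_nat l + 1)\<^sup>2 - 0)) = (fact k ^ 4 :: rat)"
    by (simp add: fact_prod_Suc prod_power_distrib atLeast0LessThan add.commute flip: power_add)
  ultimately show ?thesis
    unfolding wp_term_def by (simp add: eval_nat_numeral mult_ac)
qed

text \<open>Whipple's transformation with \<open>b = (1 + a) / 2\<close>, a parameter that is cancelled by its partner
  \<open>1 + a - b = b\<close> and so turns the \<open>\<^sub>7F\<^sub>6\<close> into a \<open>\<^sub>6F\<^sub>5\<close> with argument \<open>1\<close>.\<close>

lemma sum_wp_term:
  fixes a X t c s q :: rat and n :: nat
  defines "d \<equiv> \<lambda>l::nat. of_nat l ^ 2 + s * of_nat l + q"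
  defines "e \<equiv> \<lambda>l::nat. (a + of_nat l + 1) ^ 2 - s * (a + of_nat l + 1) + q"
  assumes a: "a \<notin> \<int>" and e: "\<And>l. e l \<noteq> 0" and c: "\<And>l. 1 + a - c + of_nat l \<noteq> 0"
    and num: "\<And>l::nat. (- of_nat n + of_nat l) * (c + of_nat l) * d l =
      ((a + of_nat l)\<^sup>2 - X) * ((a + of_nat l)\<^sup>2 - t)"
    and den: "\<And>l::nat. (1 + a + of_nat n + of_nat l) * (1 + a - c + of_nat l) * e l =
      ((of_nat l + 1)\<^sup>2 - X) * ((of_nat l + 1)\<^sup>2 - t)"
  shows "(\<Sum>k\<le>n. wp_term a X t k) =
    (\<Sum>j\<le>n. (- 1) ^ j * pochhammer ((1 + a) / 2 - c) j * pochhammer (- of_nat n) j *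
        pochhammer a (Suc (n + j)) * pochhammer (1 + a - s) (n - j) * prod d {..<j} /
        (fact j * pochhammer ((1 + a) / 2) j * pochhammer (1 + a - c) j *
          pochhammer (1 + a + of_nat n) j)) / prod e {..<n}"
proof -
  have az: "a \<noteq> of_int m" for m using a by auto
  have a1: "a + of_nat l \<noteq> 0" for l
    using az[of "- int l"] by (auto simp: add_eq_0_iff2)
  have bz: "1 + a - (1 + a) / 2 + of_nat l \<noteq> 0" for l
    using az[of "- (1 + 2 * int l)"] by (auto simp: field_simps add_eq_0_iff2)
  have b0: "1 + a - (1 + a) / 2 = (1 + a) / 2"
    by (simp add: field_simps)
  have bp: "pochhammer ((1 + a) / 2) k \<noteq> 0" for k
    using bz[unfolded b0] by (auto simp: pochhammer_eq_0_iff)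
      (metis add.left_inverse)
  have "wp_term a X t k = (a + 2 * of_nat k) * pochhammer a k * pochhammer (- of_nat n) k * prod d {..<k} /
        (fact k * pochhammer (1 + a + of_nat n) k * prod e {..<k}) *
        (pochhammer ((1 + a) / 2) k * pochhammer c k /
          (pochhammer (1 + a - (1 + a) / 2) k * pochhammer (1 + a - c) k))" for k
  proof -
    have 1: "(\<Prod>l<k. ((a + of_nat l)\<^sup>2 - X) * ((a + of_nat l)\<^sup>2 - t)) =
        pochhammer (- of_nat n) k * pochhammer c k * prod d {..<k}"
      by (simp only: pochhammer_prod atLeast0LessThan num flip: prod.distrib)
    have 2: "(\<Prod>l<k. ((of_nat l + 1)\<^sup>2 - X) * ((of_nat l + 1)\<^sup>2 - t)) =
        pochhammer (1 + a + of_nat n) k * pochhammer (1 + a - c) k * prod e {..<k}"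
      by (simp only: pochhammer_prod atLeast0LessThan den flip: prod.distrib)
    show ?thesis
      unfolding wp_term_def 1 2 b0 using bp[of k] by (simp add: mult_ac)
  qed
  thus ?thesis
    using whipple[of a s q "(1 + a) / 2" c n, folded d_def e_def, OF a1 e[unfolded e_def] bz c]
    by (simp only: b0)
qed

section \<open>The congruence for odd primes\<close>

text \<open>Evenness of \<open>n\<close> enters twice: it makes \<open>(p - 1 - n)/2\<close> an
  integer, the index at which a Pochhammer symbol meets its decisive factor, and it keeps the
  denominators \<open>(1 + a)/2 + l\<close> prime to p.\<close>

lemma wp_sum_cong:
  fixes p n :: nat and r :: int
  assumes p: "prime p" "p \<noteq> 2" "p \<noteq> 5" and n: "5 * int n = 3 * int p - r" "n < p" "even n" and r: "r \<le> 1"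
  shows "(\<Sum>k<p. wp_term (of_int r / 5) 0 0 k) \<in> padic_ideal p 4"
proof -
  define x :: rat where "x = 3 * of_nat p / 5"
  define y :: rat where "y = of_nat p / 5"
  define a :: rat where "a = of_int r / 5"
  note ideal_rules = padic_ideal_add[OF p(1)] padic_ideal_diff[OF p(1)] padic_ideal_simps[OF p(1)]
    padic_ideal_of_int[OF p(1)]
  have "of_int (5 * int n) = (of_int (3 * int p - r) :: rat)"
    using n by simp
  hence an: "a = x - of_nat n"
    by (simp add: a_def x_def field_simps)
  have "odd p"
    using p prime_odd_nat[of p] prime_gt_1_nat[of p] by (cases "p = 2") auto
  have five: "\<not> int p dvd 5" "\<not> 5 dvd int p"
    using p primes_dvd_imp_eq[of p 5] primes_dvd_imp_eq[of 5 p] by (auto simp: int_dvd_int_iff[symmetric])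
  have two: "\<not> int p dvd 2"
    using p primes_dvd_imp_eq[of p 2] by (auto simp: int_dvd_int_iff[symmetric])
  have u5: "padic_unit p 5" and u2: "padic_unit p 2"
    using padic_unit_of_int[OF p(1) five(1)] padic_unit_of_int[OF p(1) two] by simp_all
  have y1: "y \<in> padic_ideal p 1"
    unfolding y_def by (intro padic_ideal_divide p u5 padic_ideal_prime)
  have my: "of_int k * y \<in> padic_ideal p 1" for k
    by (intro padic_ideal_mult_left p y1 padic_ideal_of_int)
  have xy: "x = 3 * y" and py: "of_nat p = 5 * y"
    by (simp_all add: x_def y_def)
  have x1: "x \<in> padic_ideal p 1"
    using my[of 3] by (simp add: xy)
  have x0: "x \<in> padic_ideal p 0" and y0: "y \<in> padic_ideal p 0"
    using x1 y1 p padic_ideal_integral by blast+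
  have a0: "a \<in> padic_ideal p 0"
    unfolding an using x0 by (intro ideal_rules)
  \<comment> \<open>Since 5 does not divide p, no integer equals a multiple \<open>k y\<close> with
    k prime to 5. All conditions of Whipple's transformation that a denominator be nonzero, required
    there for every \<open>l\<close>, reduce to this.\<close>
  have nonint: "of_int m + of_int k * y \<noteq> 0" if "\<not> 5 dvd k" for m k
  proof
    assume "of_int m + of_int k * y = 0"
    hence "(of_int (5 * m + k * int p) :: rat) = 0"
      by (simp add: y_def field_simps)
    hence "5 * m + k * int p = 0"
      by (simp only: of_int_eq_0_iff)
    hence "5 dvd k * int p"
      by (metis add_eq_0_iff dvd_minus_iff dvd_triv_left)
    thus False
      using that five(2) prime_dvd_mult_iff[of "5::int"] by simp
  qed
  have aZ: "a \<notin> \<int>"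
  proof
    assume "a \<in> \<int>"
    then obtain m where "a = of_int m" by (auto elim: Ints_cases)
    thus False using nonint[of 3 "- int n - m"] by (simp add: an xy)
  qed
  define S where "S = (\<lambda>X t. \<Sum>k<p. wp_term a X t k)"
  \<comment> \<open>The coefficient for \<open>c = a + x\<close>, with \<open>a +- sqrt t\<close> as
    the symmetric pair: then \<open>s = 2 a\<close> and \<open>q = a^2 - t\<close>, so
    \<open>1 + a - s\<close> is free of \<open>t\<close>.\<close>
  define C where "C = (\<lambda>j. (- 1) ^ j * pochhammer ((1 + a) / 2 - (a + x)) j * pochhammer (- of_nat n) j *
        pochhammer a (Suc (n + j)) * pochhammer (1 + a - 2 * a) (n - j) /
        (fact j * pochhammer ((1 + a) / 2) j * pochhammer (1 + a - (a + x)) j *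
          pochhammer (1 + a + of_nat n) j))"
  \<comment> \<open>For \<open>k > n\<close> the product contains the factor \<open>l = n\<close>,
    where \<open>a + n = x\<close>.\<close>
  have trunc: "S (x\<^sup>2) t = (\<Sum>k\<le>n. wp_term a (x\<^sup>2) t k)" for t
  proof -
    have "wp_term a (x\<^sup>2) t k = 0" if "n < k" for k
    proof -
      have "(\<Prod>l<k. ((a + of_nat l)\<^sup>2 - x\<^sup>2) * ((a + of_nat l)\<^sup>2 - t)) = 0"
        by (rule prod_zero) (use that in \<open>auto simp: an intro!: bexI[of _ n]\<close>)
      thus ?thesis by (simp add: wp_term_def)
    qed
    thus ?thesis
      unfolding S_def using n(2) by (intro sum.mono_neutral_right) auto
  qed
  have S_eq: "S (x\<^sup>2) t = (\<Sum>j\<le>n. C j * (\<Prod>l<j. (a + of_nat l)\<^sup>2 - t)) / (\<Prod>l<n. (of_nat l + 1)\<^sup>2 - t)"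
    if t: "\<And>l::nat. (of_nat l + 1)\<^sup>2 - t \<noteq> 0" for t
  proof -
    have dl: "of_nat l ^ 2 + 2 * a * of_nat l + (a\<^sup>2 - t) = (a + of_nat l)\<^sup>2 - t" for l
      by (simp add: power2_eq_square algebra_simps)
    have el: "(a + of_nat l + 1) ^ 2 - 2 * a * (a + of_nat l + 1) + (a\<^sup>2 - t) = (of_nat l + 1)\<^sup>2 - t" for l
      by (simp add: power2_eq_square algebra_simps)
    have cl: "1 + a - (a + x) + of_nat l \<noteq> 0" for l
      using nonint[of "- 3" "1 + int l"] by (simp add: xy algebra_simps)
    show ?thesis
      unfolding trunc
      by (subst sum_wp_term[of a "2 * a" "a\<^sup>2 - t" "a + x" n, OF aZ, unfolded dl el, OF t cl])
        (simp_all add: C_def an power2_eq_square algebra_simps)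
  qed
  have C2: "C j \<in> padic_ideal p 2" if "j \<le> n" for j
  proof -
    \<comment> \<open>The factor at index \<open>n\<close> is \<open>a + n = x\<close>; the symbol
      has length \<open>n + j + 1\<close> and therefore always reaches it.\<close>
    have 1: "pochhammer a (Suc (n + j)) \<in> padic_ideal p 1"
      using x1 by (intro padic_ideal_pochhammer_factor[OF p(1) a0, of n]) (simp_all add: an)
    have i1: "(1 + a) / 2 - (a + x) \<in> padic_ideal p 0"
      using a0 x0 u2 by (intro ideal_rules padic_ideal_divide p)
    have i2: "1 + a - 2 * a \<in> padic_ideal p 0"
      by (intro ideal_rules padic_ideal_mult_left[OF p(1)] a0)
    txt \<open>The second factor is divisible by \<open>p\<close> for small \<open>j\<close>, the first one for large \<open>j\<close>;
      the two ranges cover all \<open>j\<close> because \<open>5 n \<ge> 3 p - 1\<close>, that is, \<open>r \<le> 1\<close>.\<close>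
    have 2: "pochhammer ((1 + a) / 2 - (a + x)) j * pochhammer (1 + a - 2 * a) (n - j) \<in> padic_ideal p 1"
    proof (cases "j + p \<le> 2 * n")
      case True
      \<comment> \<open>The sum is \<open>p - x = 5 y - 3 y\<close>; the case assumption says
        exactly that this index lies within the length \<open>n - j\<close>.\<close>
      have "1 + a - 2 * a + of_nat (p - 1 - n) = of_int 2 * y"
        using n(2) by (simp add: an of_nat_diff xy py)
      moreover have "p - 1 - n < n - j"
        using True n(2) by auto
      ultimately have "pochhammer (1 + a - 2 * a) (n - j) \<in> padic_ideal p 1"
        using my by (metis padic_ideal_pochhammer_factor[OF p(1) i2])
      thus ?thesis
        by (intro padic_ideal_mult_left p padic_ideal_pochhammer i1)
    next
      case False
      \<comment> \<open>At this index the factor is \<open>(p - x)/2 - x = y - 3 y\<close>. The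
        division is exact because p is odd and \<open>n\<close> is even.\<close>
      define l where "l = (p - 1 - n) div 2"
      have l: "2 * l = p - 1 - n"
        using n(2,3) \<open>odd p\<close> unfolding l_def by simp
      have "2 * l + n + 1 = p"
        using l n(2) by linarith
      from arg_cong[OF this, of "of_nat :: nat \<Rightarrow> rat"]
      have "(1 + a) / 2 - (a + x) + of_nat l = of_int (- 2) * y"
        by (simp add: an xy py field_simps)
      moreover have "l < j"
        using False l n r by auto
      ultimately have "pochhammer ((1 + a) / 2 - (a + x)) j \<in> padic_ideal p 1"
        using my by (metis padic_ideal_pochhammer_factor[OF p(1) i1])
      thus ?thesis
        by (intro padic_ideal_mult_right p padic_ideal_pochhammer i2)
    qed
    have "C j = (pochhammer a (Suc (n + j)) *
        (pochhammer ((1 + a) / 2 - (a + x)) j * pochhammer (1 + a - 2 * a) (n - j))) *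
        ((- 1) ^ j * pochhammer (- of_nat n) j) / (fact j * pochhammer ((1 + a) / 2) j * pochhammer (1 + a - (a + x)) j *
          pochhammer (1 + a + of_nat n) j)"
      unfolding C_def by (simp only: mult_ac)
    moreover have "\<dots> \<in> padic_ideal p 2"
    proof (intro padic_ideal_divide padic_unit_mult p)
      have "(- 1) ^ j \<in> padic_ideal p 0"
        using padic_ideal_of_int[OF p(1), of "(- 1) ^ j"] by simp
      moreover have "pochhammer (- of_nat n) j \<in> padic_ideal p 0"
        using padic_ideal_of_int[OF p(1), of "- int n"] by (intro padic_ideal_pochhammer p) simp
      moreover have "pochhammer a (Suc (n + j)) *
        (pochhammer ((1 + a) / 2 - (a + x)) j * pochhammer (1 + a - 2 * a) (n - j)) \<in> padic_ideal p 2"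
        using padic_ideal_mult[OF p(1) 1 2] by (simp only: one_add_one)
      ultimately show "pochhammer a (Suc (n + j)) *
        (pochhammer ((1 + a) / 2 - (a + x)) j * pochhammer (1 + a - 2 * a) (n - j)) *
        ((- 1) ^ j * pochhammer (- of_nat n) j) \<in> padic_ideal p 2"
        by (blast intro: padic_ideal_mult_right[OF p(1)] padic_ideal_mult_left[OF p(1)])
      show "padic_unit p (fact j)"
        using that n by (intro padic_unit_fact p) simp
      show "padic_unit p (pochhammer ((1 + a) / 2) j)"
      proof (intro padic_unit_pochhammer p)
        fix l assume "l < j"
        \<comment> \<open>Twice the factor is this integer plus \<open>x\<close>. The integer lies
          strictly between \<open>-p\<close> and \<open>p\<close>, so it could be divisible by p
          only if it were zero, which parity excludes.\<close>
        have "odd (1 - int n + 2 * int l)"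
          using n(3) by simp
        hence "1 - int n + 2 * int l \<noteq> 0" by fastforce
        hence "padic_unit p (of_int (1 - int n + 2 * int l) + x)"
          using \<open>l < j\<close> that n(2) by (intro padic_unit_add not_dvd_small p x1) auto
        hence "padic_unit p ((of_int (1 - int n + 2 * int l) + x) / 2)"
          by (intro padic_unit_divide p u2)
        thus "padic_unit p ((1 + a) / 2 + of_nat l)"
          by (simp add: an field_simps)
      qed
      show "padic_unit p (pochhammer (1 + a - (a + x)) j)"
      proof (intro padic_unit_pochhammer p)
        fix l assume "l < j"
        hence "padic_unit p (of_int (1 + int l) + - x)"
          using that n(2) by (intro padic_unit_add not_dvd_small p x1 padic_ideal_uminus) auto
        thus "padic_unit p (1 + a - (a + x) + of_nat l)"
          by (simp add: algebra_simps)
      qed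
      show "padic_unit p (pochhammer (1 + a + of_nat n) j)"
      proof (intro padic_unit_pochhammer p)
        fix l assume "l < j"
        hence "padic_unit p (of_int (1 + int l) + x)"
          using that n(2) by (intro padic_unit_add not_dvd_small p x1) auto
        thus "padic_unit p (1 + a + of_nat n + of_nat l)"
          by (simp add: an algebra_simps)
      qed
    qed
    ultimately show ?thesis by simp
  qed
  have xx: "x\<^sup>2 \<in> padic_ideal p 2" and yy: "y\<^sup>2 \<in> padic_ideal p 2" and x4: "x ^ 4 \<in> padic_ideal p 4"
    using padic_ideal_power[OF p(1) x1, of 2] padic_ideal_power[OF p(1) y1, of 2]
      padic_ideal_power[OF p(1) x1, of 4] by simp_all
  have sq_unit: "padic_unit p ((of_nat l + 1)\<^sup>2 - t)" if "l + 1 < p" "t \<in> padic_ideal p 2" for l t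
  proof -
    have "\<not> int p dvd int l + 1"
      using that by (intro not_dvd_small p) auto
    hence "padic_unit p (of_int ((int l + 1) * (int l + 1)) + - t)"
      using padic_ideal_mono[OF p(1) _ that(2), of 1]
      by (intro padic_unit_add not_dvd_mult padic_ideal_uminus p) simp_all
    thus ?thesis by (simp add: power2_eq_square)
  qed
  have sq_int: "(a + of_nat l)\<^sup>2 \<in> padic_ideal p 0" for l
    using padic_ideal_power[OF p(1), of "a + of_nat l" 0 2] a0 ideal_rules by simp
  have sq_int': "(of_nat l + 1)\<^sup>2 \<in> padic_ideal p 0" for l
    using padic_ideal_of_int[OF p(1), of "(int l + 1)\<^sup>2"] by simp
  have indep: "S (x\<^sup>2) t - S (x\<^sup>2) u \<in> padic_ideal p 4"
    if t: "\<And>l::nat. (of_nat l + 1)\<^sup>2 - t \<noteq> 0" "\<And>l::nat. (of_nat l + 1)\<^sup>2 - u \<noteq> 0"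
      "t \<in> padic_ideal p 2" "u \<in> padic_ideal p 2" for t u
  proof -
    have tu: "t \<in> padic_ideal p 0" "u \<in> padic_ideal p 0"
      using t p by (auto intro: padic_ideal_integral)
    have "z - t - (z - u) \<in> padic_ideal p 2" for z
      using padic_ideal_diff[OF p(1) t(4,3)] by simp
    note diff2 = this
    have "(a + of_nat l)\<^sup>2 - v \<in> padic_ideal p 0" "(of_nat l + 1)\<^sup>2 - v \<in> padic_ideal p 0"
      if "v = t \<or> v = u" for v and l :: nat
      using that tu padic_ideal_diff[OF p(1)] sq_int sq_int' by auto
    hence int2: "(a + of_nat l)\<^sup>2 - t \<in> padic_ideal p 0" "(a + of_nat l)\<^sup>2 - u \<in> padic_ideal p 0"
      "(of_nat l + 1)\<^sup>2 - t \<in> padic_ideal p 0" "(of_nat l + 1)\<^sup>2 - u \<in> padic_ideal p 0" for l :: nat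
      by auto
    have "S (x\<^sup>2) t - S (x\<^sup>2) u = (\<Sum>j\<le>n. C j *
      ((\<Prod>l<j. (a + of_nat l)\<^sup>2 - t) / (\<Prod>l<n. (of_nat l + 1)\<^sup>2 - t) -
       (\<Prod>l<j. (a + of_nat l)\<^sup>2 - u) / (\<Prod>l<n. (of_nat l + 1)\<^sup>2 - u)))"
      unfolding S_eq[OF t(1)] S_eq[OF t(2)] by (simp add: sum_divide_distrib right_diff_distrib sum_subtractf)
    \<comment> \<open>One \<open>p^2\<close> comes from \<open>C j\<close>, the other from the
      quotient of products, whose factors change only by \<open>t - u\<close>.\<close>
    also have "\<dots> \<in> padic_ideal p (2 + 2)"
      using n(2)
      by (intro padic_ideal_sum padic_ideal_mult padic_ideal_divide_diff C2 p padic_ideal_prod_diff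
          padic_unit_prod sq_unit padic_ideal_prod int2 diff2 t(3,4)) auto
    finally show ?thesis by simp
  qed
  have zero: "S (x\<^sup>2) (y\<^sup>2) = 0"
  proof -
    \<comment> \<open>The symmetric pair is now \<open>a + x\<close>, \<open>a - y\<close>, and
      \<open>c = a + y\<close>.\<close>
    define s where "s = 2 * a + x - y"
    define q where "q = (a + x) * (a - y)"
    have dl: "of_nat l ^ 2 + s * of_nat l + q = (of_nat l + a + x) * (of_nat l + a - y)" for l
      by (simp add: s_def q_def power2_eq_square algebra_simps)
    have el: "(a + of_nat l + 1) ^ 2 - s * (a + of_nat l + 1) + q = (of_nat l + 1 - x) * (of_nat l + 1 + y)" for l
      by (simp add: s_def q_def power2_eq_square algebra_simps)
    have e0: "(of_nat l + 1 - x) * (of_nat l + 1 + y) \<noteq> 0" for l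
      using nonint[of "- 3" "1 + int l"] nonint[of 1 "1 + int l"]
      unfolding mult_eq_0_iff de_Morgan_disj by (simp add: xy algebra_simps)
    have c0: "1 + a - (a + y) + of_nat l \<noteq> 0" for l
      using nonint[of "- 1" "1 + int l"] by (auto simp: xy algebra_simps)
    \<comment> \<open>The case split is the one used for \<open>C\<close>, but here the arguments
      are exactly \<open>-(p - 1 - n)\<close> and half of it, so one of the two symbols contains the
      factor 0.\<close>
    have "pochhammer ((1 + a) / 2 - (a + y)) j * pochhammer (1 + a - s) (n - j) = 0" if "j \<le> n" for j
    proof (cases "j + p \<le> 2 * n")
      case True
      have "1 + a - s = - of_nat (p - 1 - n)"
        using n(2) by (simp add: s_def an of_nat_diff xy py)
      moreover have "p - 1 - n < n - j"
        using True n(2) by auto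
      ultimately show ?thesis
        by (auto simp: pochhammer_eq_0_iff)
    next
      case False
      define l where "l = (p - 1 - n) div 2"
      have l: "2 * l = p - 1 - n"
        using n(2,3) \<open>odd p\<close> unfolding l_def by simp
      have "2 * l + n + 1 = p"
        using l n(2) by linarith
      from arg_cong[OF this, of "of_nat :: nat \<Rightarrow> rat"]
      have "(1 + a) / 2 - (a + y) = - of_nat l"
        by (simp add: an xy py field_simps)
      moreover have "l < j"
        using False l n r by auto
      ultimately show ?thesis
        by (auto simp: pochhammer_eq_0_iff)
    qed
    hence vanish: "pochhammer ((1 + a) / 2 - (a + y)) j = 0 \<or> pochhammer (1 + a - s) (n - j) = 0" if "j \<le> n" for j
      using that by auto
    have num: "(- of_nat n + of_nat l) * (a + y + of_nat l) * ((of_nat l + a + x) * (of_nat l + a - y)) =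
        ((a + of_nat l)\<^sup>2 - x\<^sup>2) * ((a + of_nat l)\<^sup>2 - y\<^sup>2)" for l :: nat
    proof -
      have *: "- of_nat n + of_nat l = a - x + of_nat l" by (simp add: an)
      show ?thesis unfolding * by algebra
    qed
    have den: "(1 + a + of_nat n + of_nat l) * (1 + a - (a + y) + of_nat l) *
          ((of_nat l + 1 - x) * (of_nat l + 1 + y)) =
        ((of_nat l + 1)\<^sup>2 - x\<^sup>2) * ((of_nat l + 1)\<^sup>2 - y\<^sup>2)" for l :: nat
      unfolding an by algebra
    show ?thesis
      unfolding trunc
      by (subst sum_wp_term[of a s q "a + y" n, OF aZ, unfolded dl el, OF e0 c0 num den], subst sum.neutral)
        (use vanish in auto)
  qed
  have S00: "S 0 0 - S (x\<^sup>2) (- (x\<^sup>2)) \<in> padic_ideal p 4"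
    unfolding S_def sum_subtractf[symmetric]
  proof (intro padic_ideal_sum p)
    fix k assume k: "k \<in> {..<p}"
    have f4: "(z\<^sup>2 - 0) * (z\<^sup>2 - 0) - (z\<^sup>2 - x\<^sup>2) * (z\<^sup>2 - - (x\<^sup>2)) = x ^ 4" for z :: rat
      by (simp add: power2_eq_square power4_eq_xxxx algebra_simps)
    have x20: "x\<^sup>2 \<in> padic_ideal p 0" "- (x\<^sup>2) \<in> padic_ideal p 0"
      using xx p padic_ideal_integral padic_ideal_uminus by blast+
    have fact_int: "fact k \<in> padic_ideal p 0"
      using k by (intro padic_unit_integral[OF p(1)] padic_unit_fact[OF p(1)]) simp
    have num_int: "a + 2 * of_nat k \<in> padic_ideal p 0"
      "((a + of_nat l)\<^sup>2 - 0) * ((a + of_nat l)\<^sup>2 - 0) \<in> padic_ideal p 0"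
      "((a + of_nat l)\<^sup>2 - x\<^sup>2) * ((a + of_nat l)\<^sup>2 - - (x\<^sup>2)) \<in> padic_ideal p 0"
      "((of_nat l + 1)\<^sup>2 - 0) * ((of_nat l + 1)\<^sup>2 - 0) \<in> padic_ideal p 0"
      "((of_nat l + 1)\<^sup>2 - x\<^sup>2) * ((of_nat l + 1)\<^sup>2 - - (x\<^sup>2)) \<in> padic_ideal p 0" for l :: nat
      by (intro ideal_rules padic_ideal_mult_left[OF p(1)] a0 sq_int sq_int' x20)+
    show "wp_term a 0 0 k - wp_term a (x\<^sup>2) (- (x\<^sup>2)) k \<in> padic_ideal p 4"
      unfolding wp_term_def
    proof (rule padic_ideal_divide_diff[OF p(1)])
      show "(a + 2 * of_nat k) * pochhammer a k * (\<Prod>l<k. ((a + of_nat l)\<^sup>2 - 0) * ((a + of_nat l)\<^sup>2 - 0)) -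
        (a + 2 * of_nat k) * pochhammer a k * (\<Prod>l<k. ((a + of_nat l)\<^sup>2 - x\<^sup>2) * ((a + of_nat l)\<^sup>2 - - (x\<^sup>2)))
        \<in> padic_ideal p 4"
        unfolding right_diff_distrib[symmetric]
        by (intro padic_ideal_mult_left[OF p(1)] num_int(1) padic_ideal_pochhammer[OF p(1)] a0,
            rule padic_ideal_prod_diff[OF p(1)]) (simp_all only: f4 x4 num_int)
      show "fact k * (\<Prod>l<k. ((of_nat l + 1)\<^sup>2 - 0) * ((of_nat l + 1)\<^sup>2 - 0)) -
        fact k * (\<Prod>l<k. ((of_nat l + 1)\<^sup>2 - x\<^sup>2) * ((of_nat l + 1)\<^sup>2 - - (x\<^sup>2)))
        \<in> padic_ideal p 4"
        unfolding right_diff_distrib[symmetric]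
        by (intro padic_ideal_mult_left[OF p(1)] fact_int, rule padic_ideal_prod_diff[OF p(1)])
          (simp_all only: f4 x4 num_int)
      show "(a + 2 * of_nat k) * pochhammer a k * (\<Prod>l<k. ((a + of_nat l)\<^sup>2 - x\<^sup>2) * ((a + of_nat l)\<^sup>2 - - (x\<^sup>2)))
        \<in> padic_ideal p 0"
        by (intro padic_ideal_mult_left[OF p(1)] num_int(1) padic_ideal_pochhammer[OF p(1)] a0,
            rule padic_ideal_prod[OF p(1)]) (rule num_int)
      show "padic_unit p (fact k * (\<Prod>l<k. ((of_nat l + 1)\<^sup>2 - 0) * ((of_nat l + 1)\<^sup>2 - 0)))"
        "padic_unit p (fact k * (\<Prod>l<k. ((of_nat l + 1)\<^sup>2 - x\<^sup>2) * ((of_nat l + 1)\<^sup>2 - - (x\<^sup>2))))"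
        by (intro padic_unit_mult[OF p(1)] padic_unit_prod[OF p(1)] sq_unit padic_unit_fact[OF p(1)] xx
            padic_ideal_uminus[OF p(1)] padic_ideal_zero[OF p(1)]; use k in simp)+
    qed
  qed
  have "S 0 0 = (S 0 0 - S (x\<^sup>2) (- (x\<^sup>2))) + (S (x\<^sup>2) (- (x\<^sup>2)) - S (x\<^sup>2) (y\<^sup>2))"
    by (simp add: zero)
  also have "\<dots> \<in> padic_ideal p 4"
  proof (intro padic_ideal_add p S00 indep)
    fix l :: nat
    have "(of_nat l + 1 :: rat)\<^sup>2 > 0" by (auto simp: add_eq_0_iff2)
    thus "(of_nat l + 1)\<^sup>2 - - (x\<^sup>2) \<noteq> 0"
      using zero_le_power2[of x] by linarith
    have "(of_nat l + 1)\<^sup>2 - y\<^sup>2 = (of_int (1 + int l) + of_int (- 1) * y) * (of_int (1 + int l) + of_int 1 * y)"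
      by (simp add: power2_eq_square algebra_simps)
    thus "(of_nat l + 1)\<^sup>2 - y\<^sup>2 \<noteq> 0"
      using nonint[of "- 1" "1 + int l"] nonint[of 1 "1 + int l"] by simp
  qed (use xx yy p padic_ideal_uminus in auto)
  finally show ?thesis
    by (simp add: S_def a_def)
qed

theorem theorem1:
  fixes r :: int and p :: nat
  assumes "r \<le> 1" and "odd r" and "coprime r 5"
    and "prime p"
    and "[2 * int p = - r] (mod 5)"
    and "2 * int p \<ge> 5 - r"
  shows "rat_cong_pow
           (\<Sum>k<p. (10 * of_nat k + of_int r) *
              pochhammer (of_int r / 5 :: rat) k ^ 5 / (fact k) ^ 5)
           0 p 4"
proof (cases "p = 2")
  \<comment> \<open>The argument above divides by 2. For p = 2 the bounds leave only
    \<open>r = 1\<close>, and the sum is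
    \<open>1 + 11/3125 = 3136/3125 = 2^4 * 196/3125\<close>.\<close>
  case True
  with assms have r: "r = 1" by simp
  have "(\<Sum>k<p. (10 * of_nat k + of_int r) * pochhammer (of_int r / 5 :: rat) k ^ 5 / (fact k) ^ 5) =
      of_nat (2 ^ 4) * (of_int 196 / of_int 3125)"
    by (simp add: True r numeral_2_eq_2 lessThan_Suc power_divide)
  thus ?thesis
    unfolding rat_cong_pow_def True by (intro exI[of _ 196] exI[of _ 3125]) simp
next
  case False
  have dvd: "5 dvd 2 * int p + r"
    using assms(5) by (simp add: cong_iff_dvd_diff)
  \<comment> \<open>The difference is \<open>3 p - r\<close>, which makes
    \<open>n = (3 p - r)/5\<close> an integer.\<close>
  hence "5 dvd 5 * int p - (2 * int p + r)"
    by (intro dvd_diff) auto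
  then obtain m where m: "3 * int p - r = 5 * m"
    by (auto elim!: dvdE simp: algebra_simps)
  \<comment> \<open>The lower bound comes from \<open>r \<le> 1\<close>; the upper one from
    \<open>2 p \<ge> 5 - r\<close>, which gives \<open>3 p - r < 5 p\<close>.\<close>
  have "0 \<le> m" "m < int p"
    using m assms(1,6) by auto
  then obtain n where n: "m = int n" "n < p"
    by (metis nat_int nonneg_int_cases of_nat_less_iff)
  have "odd p"
    using False assms(4) prime_odd_nat[of p] prime_gt_1_nat[of p] by (cases "p = 2") auto
  hence "even (3 * int p - r)"
    using assms(2) by simp
  hence "even n"
    by (simp add: m n)
  \<comment> \<open>If p were 5, the congruence would make 5 a divisor of \<open>r\<close>.\<close>
  have "p \<noteq> 5"
  proof
    assume "p = 5"
    hence "5 dvd r" using dvd by presburger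
    thus False using assms(3) coprime_absorb_right[of 5 r] by simp
  qed
  have "(\<Sum>k<p. (10 * of_nat k + of_int r) * pochhammer (of_int r / 5 :: rat) k ^ 5 / (fact k) ^ 5) =
      5 * (\<Sum>k<p. wp_term (of_int r / 5) 0 0 k)"
    unfolding sum_distrib_left wp_term_0_0 by (intro sum.cong refl) (simp add: field_simps)
  moreover have "\<dots> \<in> padic_ideal p 4"
    using m n False \<open>p \<noteq> 5\<close> \<open>even n\<close> assms
    by (intro padic_ideal_mult_left wp_sum_cong padic_ideal_simps) auto
  ultimately show ?thesis
    by (simp add: padic_ideal_def)
qed

end
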